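(* There exist absolute constants $\delta \in (0,1)$ and $c_0>0$ such that for arbitrarily large $n$ there is an instance of the Directed Steiner Tree problem on a directed graph with at most $n$ vertices (and with $n$ arbitrarily large along the family) whose integral optimum cost is at least $c_0\, n^{\delta}$ times the optimum value of the flow LP relaxation (FLP) of that instance. In other words, the integrality gap of (FLP) is $\Omega(n^{\delta})$, where $n$ is the number of vertices.
   Context: Directed Steiner Tree (DST): given a directed graph $G=(V,E)$ with $n=|V|$ vertices, edge costs $c\in\mathbb{R}_{\ge 0}^E$, a root $r\in V$ and a set $K\subseteq V$ of $k$ terminals, find a minimum-cost subgraph of $G$ containing a directed path from $r$ to every $t\in K$. For $t\in K$ let $\mathcal{P}_t$ be the set of simple directed $r\to t$ paths in $G$. The flow LP (FLP) is: minimize $\sum_{e\in E} c_e x_e$ subject to $\sum_{P\in\mathcal{P}_t} f^t_P = 1$ for all $t\in K$; $\sum_{P\in\mathcal{P}_t:\, e\in P} f^t_P \le x_e$ for all $e\in E,\ t\in K$; $x_e\ge 0$ for all $e\in E$; $f^t_P\ge 0$ for all $t\in K$, $P\in\mathcal{P}_t$. The integrality gap of an instance is the ratio of the minimum cost of a feasible DST solution to the optimum value of (FLP). *)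

theory Defs
  imports Complex_Main
begin

definition dst_instance ::
  "nat set \<Rightarrow> (nat \<times> nat) set \<Rightarrow> (nat \<times> nat \<Rightarrow> real) \<Rightarrow> nat \<Rightarrow> nat set \<Rightarrow> bool" where
  "dst_instance V E c r K \<longleftrightarrow> finite V \<and> E \<subseteq> V \<times> V \<and> (\<forall>e\<in>E. c e \<ge> 0) \<and> r \<in> V \<and> K \<subseteq> V"

definition path_edges :: "nat list \<Rightarrow> (nat \<times> nat) set" where
  "path_edges p = set (zip p (tl p))"

definition simple_paths :: "(nat \<times> nat) set \<Rightarrow> nat \<Rightarrow> nat \<Rightarrow> nat list set" where
  "simple_paths E r t = {p. p \<noteq> [] \<and> hd p = r \<and> last p = t \<and> distinct p \<and> path_edges p \<subseteq> E}"

definition dst_feasible :: "(nat \<times> nat) set \<Rightarrow> nat \<Rightarrow> nat set \<Rightarrow> (nat \<times> nat) set \<Rightarrow> bool" where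
  "dst_feasible E r K H \<longleftrightarrow> H \<subseteq> E \<and> (\<forall>t\<in>K. simple_paths H r t \<noteq> {})"

definition dst_opt ::
  "(nat \<times> nat) set \<Rightarrow> (nat \<times> nat \<Rightarrow> real) \<Rightarrow> nat \<Rightarrow> nat set \<Rightarrow> real" where
  "dst_opt E c r K = Inf {sum c H | H. dst_feasible E r K H}"

definition flp_feasible ::
  "(nat \<times> nat) set \<Rightarrow> nat \<Rightarrow> nat set \<Rightarrow> (nat \<times> nat \<Rightarrow> real) \<Rightarrow> (nat \<Rightarrow> nat list \<Rightarrow> real) \<Rightarrow> bool" where
  "flp_feasible E r K x f \<longleftrightarrow>
     (\<forall>t\<in>K. (\<Sum>P\<in>simple_paths E r t. f t P) = 1) \<and>
     (\<forall>e\<in>E. \<forall>t\<in>K. (\<Sum>P\<in>{P\<in>simple_paths E r t. e \<in> path_edges P}. f t P) \<le> x e) \<and>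
     (\<forall>e\<in>E. x e \<ge> 0) \<and>
     (\<forall>t\<in>K. \<forall>P\<in>simple_paths E r t. f t P \<ge> 0)"

definition flp_opt ::
  "(nat \<times> nat) set \<Rightarrow> (nat \<times> nat \<Rightarrow> real) \<Rightarrow> nat \<Rightarrow> nat set \<Rightarrow> real" where
  "flp_opt E c r K = Inf {(\<Sum>e\<in>E. c e * x e) | x f. flp_feasible E r K x f}"

end

theory Submission
  imports Defs "HOL-Library.Countable"
begin

text \<open>
  For a length \<open>m\<close> take the layers \<open>r \<rightarrow> A \<rightarrow> B\<^sub>i\<^sub>n \<rightarrow> B\<^sub>o\<^sub>u\<^sub>t \<rightarrow> T\<close>, where \<open>A\<close>, \<open>B\<close> and \<open>T\<close> are copies
  of \<open>{0,1,2}\<^sup>m\<close>. Edges \<open>a \<rightarrow> b\<close> and \<open>b \<rightarrow> t\<close> are free and present whenever the two words differ in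
  every position; \<open>r \<rightarrow> a\<close> costs \<open>1\<close> and \<open>b\<^sub>i\<^sub>n \<rightarrow> b\<^sub>o\<^sub>u\<^sub>t\<close> costs \<open>(2/3)\<^sup>m\<close>.

  Fractionally, a terminal \<open>t\<close> picks \<open>a\<close> uniformly among all words, and then each letter of \<open>b\<close>
  uniformly among those different from the letters of \<open>a\<close> and \<open>t\<close>. Every \<open>a\<close> then carries \<open>3\<^sup>-\<^sup>m\<close> and
  every \<open>b\<close> at most \<open>2\<^sup>-\<^sup>m\<close>, for a total cost of at most \<open>2\<close>.

  Integrally, \<open>a \<rightarrow> b\<close> serves the \<open>2\<^sup>m\<close> words avoiding \<open>b\<close>, and most of these agree with \<open>a\<close> in about
  \<open>m/2\<close> positions, whereas a random word agrees with \<open>a\<close> in about \<open>m/3\<close> positions. So the terminals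
  served through \<open>a\<close> nearly all lie in an exponentially small set depending on \<open>a\<close> only, and those
  outside it are an exponentially small part of the terminals below \<open>b\<close>. Both tails are bounded by
  one exponential moment, which factorises over the positions.
\<close>

section \<open>Words over three letters\<close>

definition words :: "nat \<Rightarrow> nat list set" where
  "words m = {w. length w = m \<and> set w \<subseteq> {..<3}}"

definition apart :: "nat \<Rightarrow> nat list \<Rightarrow> nat list \<Rightarrow> bool" where
  "apart m v w \<longleftrightarrow> (\<forall>i<m. v ! i \<noteq> w ! i)"

lemma words_Suc: "words (Suc m) = (\<lambda>(x, w). x # w) ` ({..<3} \<times> words m)"
  by (auto simp: words_def length_Suc_conv image_iff)

lemma finite_words [simp]: "finite (words m)"
  unfolding words_def using finite_lists_length_eq[of "{..<3::nat}" m]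
  by (simp add: conj_commute)

lemma words_nth: "w \<in> words m \<Longrightarrow> i < m \<Longrightarrow> w ! i < 3"
  unfolding words_def using nth_mem by fastforce

text \<open>Distributivity, position by position. It reduces every count, flow and exponential
  moment below to a sum over three letters.\<close>

lemma sum_words_prod:
  fixes g :: "nat \<Rightarrow> nat \<Rightarrow> 'a::comm_semiring_1"
  shows "(\<Sum>w\<in>words m. \<Prod>i<m. g i (w ! i)) = (\<Prod>i<m. \<Sum>y<3. g i y)"
proof (induction m arbitrary: g)
  case 0
  have "words 0 = {[]}" by (auto simp: words_def)
  then show ?case by simp
next
  case (Suc m)
  have "(\<Sum>w\<in>words (Suc m). \<Prod>i<Suc m. g i (w ! i))
      = (\<Sum>(x, w)\<in>{..<3} \<times> words m. g 0 x * (\<Prod>i<m. g (Suc i) (w ! i)))"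
    unfolding words_Suc
    by (subst sum.reindex) (auto simp: inj_on_def prod.lessThan_Suc_shift intro!: sum.cong simp del: prod.lessThan_Suc)
  also have "\<dots> = (\<Sum>x<3. g 0 x) * (\<Sum>w\<in>words m. \<Prod>i<m. g (Suc i) (w ! i))"
    by (simp add: sum_product sum.cartesian_product)
  also have "\<dots> = (\<Prod>i<Suc m. \<Sum>y<3. g i y)"
    by (simp only: Suc.IH[of "\<lambda>i. g (Suc i)"] prod.lessThan_Suc_shift)
  finally show ?case .
qed

lemma card_words: "card (words m) = 3 ^ m"
  using sum_words_prod[of "\<lambda>_ _. 1::nat" m] by simp

lemma sum_lessThan_3: "(\<Sum>y<3::nat. g y) = g 0 + g 1 + (g 2 :: 'a::comm_monoid_add)"
  by (simp add: numeral_3_eq_3 numeral_2_eq_2 add_ac)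

lemma less_3_cases: "x < (3::nat) \<Longrightarrow> x = 0 \<or> x = 1 \<or> x = 2"
  by auto

section \<open>The instance\<close>

text \<open>Vertices must be natural numbers, so pairs of a layer and a word are encoded
  injectively. Layer 0 holds the root, 1 is \<open>A\<close>, 2 and 3 are the two halves of
  \<open>B\<close>, 4 is \<open>T\<close>.\<close>

definition node :: "nat \<Rightarrow> nat list \<Rightarrow> nat" where
  "node k w = to_nat (k, w)"

definition word :: "nat \<Rightarrow> nat list" where
  "word v = snd (from_nat v :: nat \<times> nat list)"

abbreviation source :: nat where
  "source \<equiv> node 0 []"

definition verts :: "nat \<Rightarrow> nat set" where
  "verts m = insert source (\<Union>k\<in>{1,2,3,4}. node k ` words m)"

definition terminals :: "nat \<Rightarrow> nat set" where
  "terminals m = node 4 ` words m"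

definition edges :: "nat \<Rightarrow> (nat \<times> nat) set" where
  "edges m =
     {(source, node 1 a) | a. a \<in> words m} \<union>
     {(node 1 a, node 2 b) | a b. a \<in> words m \<and> b \<in> words m \<and> apart m a b} \<union>
     {(node 2 b, node 3 b) | b. b \<in> words m} \<union>
     {(node 3 b, node 4 t) | b t. b \<in> words m \<and> t \<in> words m \<and> apart m b t}"

text \<open>The price \<open>(2/3) ^ m\<close> offsets the \<open>3 ^ m\<close> middle edges of
  capacity \<open>(1/2) ^ m\<close>, so that both paid layers cost 1 fractionally.\<close>

definition cost :: "nat \<Rightarrow> nat \<times> nat \<Rightarrow> real" where
  "cost m e = (if e \<in> range (\<lambda>a. (source, node 1 a)) then 1
               else if e \<in> range (\<lambda>b. (node 2 b, node 3 b)) then (2/3) ^ m else 0)"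

definition route :: "nat list \<Rightarrow> nat list \<Rightarrow> nat list \<Rightarrow> nat list" where
  "route a b t = [source, node 1 a, node 2 b, node 3 b, node 4 t]"

lemma node_eq [simp]: "node k v = node l w \<longleftrightarrow> k = l \<and> v = w"
  by (simp add: node_def)

lemma word_node [simp]: "word (node k w) = w"
  by (simp add: word_def node_def)

lemma finite_verts: "finite (verts m)"
  by (auto simp: verts_def)

lemma edges_subset: "edges m \<subseteq> verts m \<times> verts m"
  by (auto simp: edges_def verts_def)

lemma finite_edges: "finite (edges m)"
  using edges_subset finite_verts finite_subset by blast

lemma dst_instance_words: "dst_instance (verts m) (edges m) (cost m) source (terminals m)"
proof -
  have "cost m e \<ge> 0" for e by (simp add: cost_def)
  moreover have "source \<in> verts m" "terminals m \<subseteq> verts m" by (auto simp: verts_def terminals_def)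
  ultimately show ?thesis
    using finite_verts edges_subset by (simp add: dst_instance_def)
qed

lemma card_verts: "card (verts m) \<le> 5 * 3 ^ m"
proof -
  have "card (\<Union>k\<in>{1,2,3,4}. node k ` words m) \<le> (\<Sum>k\<in>{1,2,3,4::nat}. card (node k ` words m))"
    by (rule card_UN_le) simp
  also have "\<dots> \<le> (\<Sum>k\<in>{1,2,3,4::nat}. 3 ^ m)"
    by (intro sum_mono) (metis card_image_le card_words finite_words)
  finally have "card (\<Union>k\<in>{1,2,3,4}. node k ` words m) \<le> 4 * 3 ^ m" by simp
  moreover have "card (verts m) \<le> Suc (card (\<Union>k\<in>{1,2,3,4}. node k ` words m))"
    unfolding verts_def by (rule card_insert_le_m1) auto
  moreover have "(1::nat) \<le> 3 ^ m" by simp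
  ultimately show ?thesis by linarith
qed

text \<open>Used for fractional solutions and, with \<open>x\<close> the indicator of an edge set,
  for integral ones.\<close>

lemma sum_cost:
  "(\<Sum>e\<in>edges m. cost m e * x e)
     = (\<Sum>a\<in>words m. x (source, node 1 a)) + (2/3) ^ m * (\<Sum>b\<in>words m. x (node 2 b, node 3 b))"
proof -
  let ?R = "(\<lambda>a. (source, node 1 a)) ` words m"
  let ?M = "(\<lambda>b. (node 2 b, node 3 b)) ` words m"
  have "(\<Sum>e\<in>edges m. cost m e * x e) = (\<Sum>e\<in>?R \<union> ?M. cost m e * x e)"
    by (rule sum.mono_neutral_right[OF finite_edges]) (auto simp: edges_def cost_def)
  also have "\<dots> = (\<Sum>e\<in>?R. cost m e * x e) + (\<Sum>e\<in>?M. cost m e * x e)"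
    by (rule sum.union_disjoint) auto
  also have "(\<Sum>e\<in>?R. cost m e * x e) = (\<Sum>a\<in>words m. x (source, node 1 a))"
    by (subst sum.reindex) (auto simp: inj_on_def cost_def)
  also have "(\<Sum>e\<in>?M. cost m e * x e) = (2/3) ^ m * (\<Sum>b\<in>words m. x (node 2 b, node 3 b))"
    by (subst sum.reindex) (auto simp: inj_on_def cost_def sum_distrib_left image_iff)
  finally show ?thesis .
qed

lemma path_edges_simps [simp]:
  "path_edges [v] = {}"
  "path_edges (v # w # p) = insert (v, w) (path_edges (w # p))"
  by (auto simp: path_edges_def)

lemma simple_paths_mono: "H \<subseteq> E \<Longrightarrow> simple_paths H r t \<subseteq> simple_paths E r t"
  by (auto simp: simple_paths_def)

lemma route_in_simple_paths:
  "path_edges (route a b t) \<subseteq> E \<Longrightarrow> route a b t \<in> simple_paths E source (node 4 t)"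
  by (auto simp: simple_paths_def route_def)

lemma simple_paths_edges:
  assumes "t \<in> words m"
  shows "simple_paths (edges m) source (node 4 t)
    = (\<lambda>(a, b). route a b t) ` {(a, b) \<in> words m \<times> words m. apart m a b \<and> apart m b t}"
proof (intro equalityI subsetI)
  fix p assume p: "p \<in> simple_paths (edges m) source (node 4 t)"
  then obtain p1 where p1: "p = source # p1" "p1 \<noteq> []" "path_edges p \<subseteq> edges m" "last p1 = node 4 t"
    by (cases p) (auto simp: simple_paths_def split: if_splits)
  then obtain a p2 where p2: "p1 = node 1 a # p2" "a \<in> words m" "path_edges p1 \<subseteq> edges m"
    by (cases p1) (auto simp: edges_def)
  then obtain b p3 where p3: "p2 = node 2 b # p3" "b \<in> words m" "apart m a b" "path_edges p2 \<subseteq> edges m"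
    using p1 by (cases p2) (auto simp: edges_def)
  then obtain p4 where p4: "p3 = node 3 b # p4" "path_edges p3 \<subseteq> edges m"
    using p1 p2 by (cases p3) (auto simp: edges_def)
  then obtain s p5 where p5: "p4 = node 4 s # p5" "apart m b s" "path_edges p4 \<subseteq> edges m"
    using p1 p2 p3 by (cases p4) (auto simp: edges_def)
  \<comment> \<open>Terminals have no outgoing edge, so the path ends here and
    \<open>s = t\<close>.\<close>
  then have "p5 = []"
    by (cases p5) (auto simp: edges_def)
  then show "p \<in> (\<lambda>(a, b). route a b t) ` {(a, b) \<in> words m \<times> words m. apart m a b \<and> apart m b t}"
    using p1 p2 p3 p4 p5 by (auto simp: route_def image_iff)
next
  fix p assume "p \<in> (\<lambda>(a, b). route a b t) ` {(a, b) \<in> words m \<times> words m. apart m a b \<and> apart m b t}"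
  then obtain a b where p: "p = route a b t"
    and ab: "a \<in> words m" "b \<in> words m" "apart m a b" "apart m b t" by auto
  have "path_edges (route a b t) \<subseteq> edges m"
    using assms ab by (auto simp: route_def edges_def)
  then show "p \<in> simple_paths (edges m) source (node 4 t)"
    unfolding p by (rule route_in_simple_paths)
qed

lemma finite_simple_paths_edges:
  "t \<in> words m \<Longrightarrow> finite (simple_paths (edges m) source (node 4 t))"
  unfolding simple_paths_edges
  by (intro finite_imageI, rule finite_subset[of _ "words m \<times> words m"]) auto

section \<open>The fractional optimum\<close>

text \<open>Joint law of one letter of \<open>a\<close> and of \<open>b\<close> given that of
  \<open>t\<close>: two choices of \<open>b\<close> remain when \<open>a = t\<close>, giving 1/6
  each, and only one otherwise, giving 1/3.\<close>

definition letter_flow :: "nat \<Rightarrow> nat \<Rightarrow> nat \<Rightarrow> real" where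
  "letter_flow t a b = (if b = t then 0 else if a = t then 1/6 else if b = a then 0 else 1/3)"

definition word_flow :: "nat \<Rightarrow> nat list \<Rightarrow> nat list \<Rightarrow> nat list \<Rightarrow> real" where
  "word_flow m t a b = (\<Prod>i<m. letter_flow (t ! i) (a ! i) (b ! i))"

definition path_flow :: "nat \<Rightarrow> nat \<Rightarrow> nat list \<Rightarrow> real" where
  "path_flow m t P = word_flow m (word t) (word (P ! 1)) (word (P ! 2))"

text \<open>Free edges get 1, the total flow of a terminal, at no cost.\<close>

definition capacity :: "nat \<Rightarrow> nat \<times> nat \<Rightarrow> real" where
  "capacity m e = (if e \<in> range (\<lambda>a. (source, node 1 a)) then (1/3) ^ m
                   else if e \<in> range (\<lambda>b. (node 2 b, node 3 b)) then (1/2) ^ m else 1)"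

lemma letter_flow_nonneg: "letter_flow t a b \<ge> 0"
  by (simp add: letter_flow_def)

lemma word_flow_nonneg: "word_flow m t a b \<ge> 0"
  by (simp add: word_flow_def prod_nonneg letter_flow_nonneg)

lemma word_flow_eq_0:
  assumes "\<not> (apart m a b \<and> apart m b t)"
  shows "word_flow m t a b = 0"
proof -
  obtain i where "i < m" "letter_flow (t ! i) (a ! i) (b ! i) = 0"
    using assms by (auto simp: apart_def letter_flow_def)
  then show ?thesis by (auto simp: word_flow_def)
qed

lemma sum_letter_flow_b: "t < 3 \<Longrightarrow> a < 3 \<Longrightarrow> (\<Sum>b<3. letter_flow t a b) = 1/3"
  by (auto dest!: less_3_cases simp: sum_lessThan_3 letter_flow_def)

text \<open>For \<open>b = t\<close> the sum is 0; otherwise \<open>a = t\<close> gives 1/6,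
  \<open>a = b\<close> gives 0 and the third letter 1/3.\<close>

lemma sum_letter_flow_a: "t < 3 \<Longrightarrow> b < 3 \<Longrightarrow> (\<Sum>a<3. letter_flow t a b) \<le> 1/2"
  by (auto dest!: less_3_cases simp: sum_lessThan_3 letter_flow_def)

lemma sum_word_flow_b:
  assumes "t \<in> words m" "a \<in> words m"
  shows "(\<Sum>b\<in>words m. word_flow m t a b) = (1/3) ^ m"
proof -
  have "(\<Sum>b\<in>words m. word_flow m t a b) = (\<Prod>i<m. \<Sum>y<3. letter_flow (t ! i) (a ! i) y)"
    unfolding word_flow_def by (rule sum_words_prod)
  also have "\<dots> = (\<Prod>i<m. 1/3)"
    using assms by (intro prod.cong sum_letter_flow_b) (auto intro: words_nth)
  finally show ?thesis by simp
qed

lemma sum_word_flow_a: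
  assumes "t \<in> words m" "b \<in> words m"
  shows "(\<Sum>a\<in>words m. word_flow m t a b) \<le> (1/2) ^ m"
proof -
  have "(\<Sum>a\<in>words m. word_flow m t a b) = (\<Prod>i<m. \<Sum>y<3. letter_flow (t ! i) y (b ! i))"
    unfolding word_flow_def by (rule sum_words_prod)
  also have "\<dots> \<le> (\<Prod>i<m. 1/2)"
    using assms
    by (intro prod_mono conjI sum_nonneg letter_flow_nonneg sum_letter_flow_a) (auto intro: words_nth)
  finally show ?thesis by simp
qed

text \<open>Pairs that form no route carry no flow, so the sum extends to all pairs of words, where
  it factorises. The predicate \<open>Q\<close> covers both the total flow and the load of one
  edge.\<close>

lemma sum_path_flow:
  assumes "t \<in> words m"
  shows "(\<Sum>P\<in>{P \<in> simple_paths (edges m) source (node 4 t). Q P}. path_flow m (node 4 t) P)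
    = (\<Sum>(a, b)\<in>{(a, b) \<in> words m \<times> words m. Q (route a b t)}. word_flow m t a b)"
proof -
  let ?S = "{(a, b) \<in> words m \<times> words m. apart m a b \<and> apart m b t \<and> Q (route a b t)}"
  have "{P \<in> simple_paths (edges m) source (node 4 t). Q P} = (\<lambda>(a, b). route a b t) ` ?S"
    unfolding simple_paths_edges[OF assms] by auto
  moreover have "inj_on (\<lambda>(a, b). route a b t) ?S"
    by (auto simp: inj_on_def route_def)
  ultimately have "(\<Sum>P\<in>{P \<in> simple_paths (edges m) source (node 4 t). Q P}. path_flow m (node 4 t) P)
      = (\<Sum>(a, b)\<in>?S. word_flow m t a b)"
    by (simp add: sum.reindex path_flow_def route_def split_def)
  also have "\<dots> = (\<Sum>(a, b)\<in>{(a, b) \<in> words m \<times> words m. Q (route a b t)}. word_flow m t a b)"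
  proof (rule sum.mono_neutral_left)
    show "finite {(a, b) \<in> words m \<times> words m. Q (route a b t)}"
      by (rule finite_subset[of _ "words m \<times> words m"]) auto
  qed (auto intro: word_flow_eq_0)
  finally show ?thesis .
qed

lemma total_word_flow:
  assumes "t \<in> words m"
  shows "(\<Sum>(a, b)\<in>words m \<times> words m. word_flow m t a b) = 1"
proof -
  have "(\<Sum>(a, b)\<in>words m \<times> words m. word_flow m t a b)
      = (\<Sum>a\<in>words m. \<Sum>b\<in>words m. word_flow m t a b)"
    by (simp add: sum.cartesian_product)
  also have "\<dots> = 1"
    by (simp add: sum_word_flow_b assms card_words power_divide)
  finally show ?thesis .
qed

text \<open>A root edge fixes \<open>a\<close> and a middle edge fixes \<open>b\<close>, leaving a
  one-word marginal; on a free edge the total flow 1 is enough.\<close>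

lemma path_flow_le_capacity:
  assumes t: "t \<in> words m" and e: "e \<in> edges m"
  shows "(\<Sum>P\<in>{P \<in> simple_paths (edges m) source (node 4 t). e \<in> path_edges P}. path_flow m (node 4 t) P)
    \<le> capacity m e"
proof -
  let ?S = "{(a, b) \<in> words m \<times> words m. e \<in> path_edges (route a b t)}"
  have le: "(\<Sum>(a, b)\<in>?S. word_flow m t a b) \<le> (\<Sum>(a, b)\<in>S'. word_flow m t a b)"
    if "?S \<subseteq> S'" "finite S'" for S'
    using that by (intro sum_mono2) (auto simp: word_flow_nonneg)
  consider (root) a where "e = (source, node 1 a)" "a \<in> words m"
    | (middle) b where "e = (node 2 b, node 3 b)" "b \<in> words m"
    | (free) "\<forall>a. e \<noteq> (source, node 1 a)" "\<forall>b. e \<noteq> (node 2 b, node 3 b)"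
    using e by (auto simp: edges_def)
  then have "(\<Sum>(a, b)\<in>?S. word_flow m t a b) \<le> capacity m e"
  proof cases
    case (root a)
    have "(\<Sum>(a, b)\<in>?S. word_flow m t a b) \<le> (\<Sum>(a, b)\<in>{a} \<times> words m. word_flow m t a b)"
      by (rule le) (auto simp: root route_def)
    also have "\<dots> = (1/3) ^ m"
      using sum_word_flow_b[OF t root(2)] by (simp flip: sum.cartesian_product)
    also have "\<dots> = capacity m e"
      by (simp add: root capacity_def)
    finally show ?thesis .
  next
    case (middle b)
    have "(\<Sum>(a, b)\<in>?S. word_flow m t a b) \<le> (\<Sum>(a, b)\<in>words m \<times> {b}. word_flow m t a b)"
      by (rule le) (auto simp: middle route_def)
    also have "\<dots> \<le> (1/2) ^ m"
      using sum_word_flow_a[OF t middle(2)] by (simp flip: sum.cartesian_product)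
    also have "\<dots> = capacity m e"
      by (auto simp: middle capacity_def)
    finally show ?thesis .
  next
    case free
    have "(\<Sum>(a, b)\<in>?S. word_flow m t a b) \<le> (\<Sum>(a, b)\<in>words m \<times> words m. word_flow m t a b)"
      by (rule le) auto
    then show ?thesis
      using free by (simp add: capacity_def image_iff total_word_flow[OF t])
  qed
  then show ?thesis
    by (simp add: sum_path_flow[OF t])
qed

lemma flp_feasible_capacity: "flp_feasible (edges m) source (terminals m) (capacity m) (path_flow m)"
proof -
  have "(\<Sum>P\<in>simple_paths (edges m) source (node 4 t). path_flow m (node 4 t) P) = 1"
    if "t \<in> words m" for t
    using sum_path_flow[OF that, of "\<lambda>_. True"] total_word_flow[OF that]
    by (simp flip: Sigma_def)
  moreover have "path_flow m t P \<ge> 0" for t P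
    by (simp add: path_flow_def word_flow_nonneg)
  moreover have "capacity m e \<ge> 0" for e
    by (simp add: capacity_def)
  ultimately show ?thesis
    unfolding flp_feasible_def terminals_def using path_flow_le_capacity by simp
qed

lemma cost_capacity: "(\<Sum>e\<in>edges m. cost m e * capacity m e) = 2"
proof -
  have "(\<Sum>a\<in>words m. capacity m (source, node 1 a)) = 1"
    by (simp add: capacity_def card_words power_divide)
  moreover have "(\<Sum>b\<in>words m. capacity m (node 2 b, node 3 b)) = (3/2) ^ m"
    by (simp add: capacity_def card_words power_divide image_iff)
  moreover have "(2/3) ^ m * (3/2) ^ m = (1::real)"
    by (simp flip: power_mult_distrib)
  ultimately show ?thesis
    by (simp add: sum_cost)
qed

text \<open>The root edges form a cut of unit-cost edges that a single terminal already crosses with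
  flow 1. This makes the infimum positive and the set of costs bounded below.\<close>

lemma flp_cost_ge_1:
  assumes "flp_feasible (edges m) source (terminals m) x f"
  shows "(\<Sum>e\<in>edges m. cost m e * x e) \<ge> 1"
proof -
  define t where "t = replicate m (0::nat)"
  have t: "t \<in> words m" by (auto simp: t_def words_def)
  let ?P = "simple_paths (edges m) source (node 4 t)"
  let ?Pa = "\<lambda>a. {P \<in> ?P. (source, node 1 a) \<in> path_edges P}"
  have [simp]: "finite ?P" using finite_simple_paths_edges[OF t] .
  have f: "(\<Sum>P\<in>?P. f (node 4 t) P) = 1" "\<And>P. P \<in> ?P \<Longrightarrow> f (node 4 t) P \<ge> 0"
    using assms t by (auto simp: flp_feasible_def terminals_def)
  have x: "x e \<ge> 0" if "e \<in> edges m" for e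
    using assms that by (auto simp: flp_feasible_def)
  have "?P = (\<Union>a\<in>words m. ?Pa a)"
    by (auto simp: simple_paths_edges[OF t] route_def)
  then have "1 = (\<Sum>P\<in>(\<Union>a\<in>words m. ?Pa a). f (node 4 t) P)"
    using f(1) by simp
  also have "\<dots> = (\<Sum>a\<in>words m. \<Sum>P\<in>?Pa a. f (node 4 t) P)"
  proof (rule sum.UNION_disjoint)
    show "\<forall>a\<in>words m. \<forall>a'\<in>words m. a \<noteq> a' \<longrightarrow> ?Pa a \<inter> ?Pa a' = {}"
      by (auto simp: simple_paths_edges[OF t] route_def)
  qed auto
  also have "\<dots> \<le> (\<Sum>a\<in>words m. x (source, node 1 a))"
    using assms t by (intro sum_mono) (auto simp: flp_feasible_def terminals_def edges_def)
  also have "\<dots> \<le> (\<Sum>e\<in>edges m. cost m e * x e)"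
    unfolding sum_cost using x by (auto simp: edges_def intro!: mult_nonneg_nonneg sum_nonneg)
  finally show ?thesis .
qed

lemma flp_opt_bounds:
  "1 \<le> flp_opt (edges m) (cost m) source (terminals m)"
  "flp_opt (edges m) (cost m) source (terminals m) \<le> 2"
proof -
  let ?C = "{(\<Sum>e\<in>edges m. cost m e * x e) | x f. flp_feasible (edges m) source (terminals m) x f}"
  have two: "2 \<in> ?C"
    using flp_feasible_capacity cost_capacity by force
  have ge: "y \<ge> 1" if "y \<in> ?C" for y
    using that flp_cost_ge_1 by auto
  show "1 \<le> flp_opt (edges m) (cost m) source (terminals m)"
    unfolding flp_opt_def using two ge by (intro cInf_greatest) auto
  show "flp_opt (edges m) (cost m) source (terminals m) \<le> 2"
    unfolding flp_opt_def using two ge by (intro cInf_lower bdd_belowI[of _ 1]) auto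
qed

section \<open>The integral optimum\<close>

text \<open>
  The factors \<open>5/4\<close> and \<open>6/7\<close> are chosen such that \<open>5/4 + 2 * (6/7) < 3\<close> and \<open>4/5 + 7/6 < 2\<close>.
\<close>

definition likeness :: "nat \<Rightarrow> nat list \<Rightarrow> nat list \<Rightarrow> real" where
  "likeness m a t = (\<Prod>i<m. if a ! i = t ! i then 5/4 else 6/7)"

lemma likeness_pos: "likeness m a t > 0"
  by (simp add: likeness_def prod_pos)

text \<open>One letter agrees and two differ: \<open>5/4 + 2 * (6/7) = 83/28\<close>.\<close>

lemma sum_likeness:
  assumes "a \<in> words m"
  shows "(\<Sum>t\<in>words m. likeness m a t) = (83/28) ^ m"
proof -
  have "(\<Sum>y<3. if x = y then 5/4 else 6/7 :: real) = 83/28" if "x < 3" for x :: nat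
    using less_3_cases[OF that] by (auto simp: sum_lessThan_3)
  then have "(\<Prod>i<m. \<Sum>y<3. if a ! i = y then 5/4 else 6/7 :: real) = (\<Prod>i<m. 83/28)"
    using words_nth[OF assms] by (intro prod.cong) auto
  then show ?thesis
    unfolding likeness_def by (subst sum_words_prod) simp
qed

text \<open>Of the two letters avoiding that of \<open>b\<close>, exactly one is the letter of
  \<open>a\<close>: \<open>4/5 + 7/6 = 59/30\<close>.\<close>

lemma sum_inverse_likeness:
  assumes "a \<in> words m" "b \<in> words m" "apart m a b"
  shows "(\<Sum>t\<in>{t \<in> words m. apart m b t}. inverse (likeness m a t)) = (59/30) ^ m"
proof -
  \<comment> \<open>The zero factor encodes \<open>apart m b t\<close>, so that the sum may run over
    all words.\<close>
  let ?g = "\<lambda>x z y. if z = y then 0 else if x = y then 4/5 else 7/6 :: real"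
  have letters: "(\<Sum>y<3. ?g x z y) = 59/30" if "x < 3" "z < 3" "x \<noteq> z" for x z :: nat
    using that by (auto dest!: less_3_cases simp: sum_lessThan_3)
  have "inverse (likeness m a t) = (\<Prod>i<m. ?g (a ! i) (b ! i) (t ! i))" if "apart m b t" for t
    using that unfolding likeness_def prod_inversef[symmetric] apart_def
    by (intro prod.cong) auto
  then have "(\<Sum>t\<in>{t \<in> words m. apart m b t}. inverse (likeness m a t))
      = (\<Sum>t\<in>{t \<in> words m. apart m b t}. \<Prod>i<m. ?g (a ! i) (b ! i) (t ! i))"
    by (intro sum.cong) auto
  also have "\<dots> = (\<Sum>t\<in>words m. \<Prod>i<m. ?g (a ! i) (b ! i) (t ! i))"
    by (rule sum.mono_neutral_left) (auto simp: apart_def)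
  also have "\<dots> = (\<Prod>i<m. \<Sum>y<3. ?g (a ! i) (b ! i) y)"
    by (rule sum_words_prod)
  also have "\<dots> = (\<Prod>i<m. 59/30)"
    using assms by (intro prod.cong letters) (auto simp: words_nth apart_def)
  finally show ?thesis by simp
qed

text \<open>A flow of value 1 cannot live on an empty set of paths.\<close>

lemma dst_feasible_edges: "dst_feasible (edges m) source (terminals m) (edges m)"
proof -
  have "simple_paths (edges m) source (node 4 t) \<noteq> {}" if "t \<in> words m" for t
  proof
    assume "simple_paths (edges m) source (node 4 t) = {}"
    then show False
      using flp_feasible_capacity[of m] that by (auto simp: flp_feasible_def terminals_def)
  qed
  then show ?thesis by (auto simp: dst_feasible_def terminals_def)
qed

text \<open>Each terminal is charged to a bought \<open>a\<close> with weight
  \<open>likeness\<close> or to a bought \<open>b\<close> with its inverse; summing over all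
  terminals bounds the purchase from below.\<close>

lemma dst_cost_ge:
  assumes "dst_feasible (edges m) source (terminals m) H"
  shows "sum (cost m) H \<ge> (84/83) ^ m"
proof -
  have H: "H \<subseteq> edges m" using assms by (simp add: dst_feasible_def)
  define A where "A = {a \<in> words m. (source, node 1 a) \<in> H}"
  define B where "B = {b \<in> words m. (node 2 b, node 3 b) \<in> H \<and> (\<exists>a\<in>A. apart m a b)}"
  have fin [simp]: "finite A" "finite B" by (simp_all add: A_def B_def)
  \<comment> \<open>One parent per \<open>b\<close> is fixed, so that the charge to \<open>b\<close>
    does not depend on the route of \<open>t\<close>; the parent may differ from the
    \<open>a\<close> on that route.\<close>
  obtain parent where parent: "\<And>b. b \<in> B \<Longrightarrow> parent b \<in> A \<and> apart m (parent b) b"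
    using that[of "\<lambda>b. SOME a. a \<in> A \<and> apart m a b"] unfolding B_def
    by (metis (mono_tags, lifting) mem_Collect_eq someI_ex)

  have served: "1 \<le> (\<Sum>a\<in>A. likeness m a t)
      + (\<Sum>b\<in>B. if apart m b t then inverse (likeness m (parent b) t) else 0)"
    (is "1 \<le> ?L + ?M") if t: "t \<in> words m" for t
  proof -
    obtain p where p: "p \<in> simple_paths H source (node 4 t)"
      using assms t by (auto simp: dst_feasible_def terminals_def)
    then have "p \<in> simple_paths (edges m) source (node 4 t)"
      using simple_paths_mono[OF H] by blast
    then obtain a b where "p = route a b t" "a \<in> words m" "b \<in> words m" "apart m a b" "apart m b t"
      unfolding simple_paths_edges[OF t] by auto
    moreover from this p have "(source, node 1 a) \<in> H" "(node 2 b, node 3 b) \<in> H"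
      by (auto simp: simple_paths_def route_def)
    ultimately have b: "b \<in> B" "apart m b t" by (auto simp: A_def B_def)
    have "likeness m (parent b) t \<le> ?L"
      using parent[OF b(1)] by (intro member_le_sum) (auto intro: less_imp_le likeness_pos)
    moreover have "(if apart m b t then inverse (likeness m (parent b) t) else 0) \<le> ?M"
      using b(1) by (intro member_le_sum) (auto intro: less_imp_le likeness_pos)
    \<comment> \<open>With \<open>l\<close> the likeness of \<open>parent b\<close> and
      \<open>t\<close>, one of the two charges is at least 1.\<close>
    moreover have "1 \<le> l \<or> 1 \<le> inverse l" if "l > 0" for l :: real
      using that by (auto simp: one_le_inverse_iff)
    ultimately show ?thesis
      using b(2) likeness_pos[of m "parent b" t]
      by (smt (verit) positive_imp_inverse_positive)
  qed

  have "3 ^ m = (\<Sum>t\<in>words m. 1::real)"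
    by (simp add: card_words)
  also have "\<dots> \<le> (\<Sum>t\<in>words m. (\<Sum>a\<in>A. likeness m a t)
      + (\<Sum>b\<in>B. if apart m b t then inverse (likeness m (parent b) t) else 0))"
    by (intro sum_mono served)
  also have "\<dots> = (\<Sum>a\<in>A. \<Sum>t\<in>words m. likeness m a t)
      + (\<Sum>b\<in>B. \<Sum>t\<in>words m. if apart m b t then inverse (likeness m (parent b) t) else 0)"
    by (simp add: sum.distrib sum.swap[of _ "words m"])
  also have "(\<Sum>a\<in>A. \<Sum>t\<in>words m. likeness m a t) = card A * (83/28) ^ m"
    by (simp add: sum_likeness A_def)
  also have "(\<Sum>b\<in>B. \<Sum>t\<in>words m. if apart m b t then inverse (likeness m (parent b) t) else 0)
      = (\<Sum>b\<in>B. (59/30) ^ m)"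
  proof (rule sum.cong)
    fix b assume b: "b \<in> B"
    then show "(\<Sum>t\<in>words m. if apart m b t then inverse (likeness m (parent b) t) else 0)
        = (59/30) ^ m"
      using parent[OF b] sum_inverse_likeness[of "parent b" m b]
      by (simp add: sum.inter_filter A_def B_def)
  qed simp
  also have "\<dots> = card B * (59/30) ^ m" by simp
  \<comment> \<open>\<open>59/30 < 83/42\<close>: this matches the price \<open>(2/3) ^ m\<close> of
    a middle edge.\<close>
  also have "\<dots> \<le> card B * ((2/3) * (83/28)) ^ m"
    by (intro mult_left_mono power_mono) auto
  finally have bound: "3 ^ m \<le> (card A + (2/3) ^ m * card B) * (83/28 :: real) ^ m"
    unfolding power_mult_distrib by (simp add: algebra_simps)

  have "sum (cost m) H = (\<Sum>e\<in>edges m. cost m e * of_bool (e \<in> H))"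
    using H finite_edges by (simp add: sum.inter_restrict[symmetric] of_bool_def if_distrib Int_absorb1 cong: if_cong)
  also have "\<dots> = card A + (2/3) ^ m * card {b \<in> words m. (node 2 b, node 3 b) \<in> H}"
    by (simp add: sum_cost A_def of_bool_def sum.inter_filter[symmetric])
  also have "\<dots> \<ge> card A + (2/3) ^ m * card B"
    by (intro add_left_mono mult_left_mono) (auto simp: B_def intro!: card_mono)
  finally have "card A + (2/3) ^ m * card B \<le> sum (cost m) H" .
  then have "3 ^ m \<le> sum (cost m) H * (83/28) ^ m"
    using bound by (meson mult_right_mono order_trans zero_le_divide_iff zero_le_numeral zero_le_power)
  moreover have "(3::real) ^ m = (84/83) ^ m * (83/28) ^ m"
    by (simp flip: power_mult_distrib)
  ultimately show ?thesis by simp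
qed

lemma dst_opt_ge: "dst_opt (edges m) (cost m) source (terminals m) \<ge> (84/83) ^ m"
  unfolding dst_opt_def using dst_feasible_edges dst_cost_ge
  by (intro cInf_greatest) blast+

theorem theorem1:
  shows "\<exists>(\<delta>::real) (c0::real). 0 < \<delta> \<and> \<delta> < 1 \<and> 0 < c0 \<and>
    (\<forall>N::nat. \<exists>n::nat. n \<ge> N \<and>
       (\<exists>V E c r K. dst_instance V E c r K \<and> card V \<le> n \<and>
          (\<exists>H. dst_feasible E r K H) \<and>
          flp_opt E c r K > 0 \<and>
          dst_opt E c r K \<ge> c0 * real n powr \<delta> * flp_opt E c r K))"
proof -
  \<comment> \<open>Chosen so that \<open>3 powr \<delta> = 84/83\<close>: the gap grows like
    \<open>(84/83) ^ m\<close> on about \<open>3 ^ m\<close> vertices.\<close>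
  define \<delta> :: real where "\<delta> = log 3 (84/83)"
  have \<delta>: "0 < \<delta>" "\<delta> < 1" by (simp_all add: \<delta>_def)
  \<comment> \<open>The constant \<open>1/10\<close> absorbs \<open>5 powr \<delta> \<le> 5\<close>
    and the bound 2 on \<open>flp_opt\<close>.\<close>
  have gap: "dst_opt (edges m) (cost m) source (terminals m)
      \<ge> 1/10 * real (5 * 3 ^ m) powr \<delta> * flp_opt (edges m) (cost m) source (terminals m)" for m
  proof -
    have "real (5 * 3 ^ m) powr \<delta> = 5 powr \<delta> * (3 powr \<delta>) ^ m"
      by (simp add: powr_mult powr_powr powr_power mult.commute flip: powr_realpow)
    also have "3 powr \<delta> = 84/83"
      by (simp add: \<delta>_def)
    also have "5 powr \<delta> * (84/83) ^ m \<le> 5 powr 1 * (84/83) ^ m"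
      using \<delta> by (intro mult_right_mono powr_mono) auto
    finally have "real (5 * 3 ^ m) powr \<delta> * flp_opt (edges m) (cost m) source (terminals m)
        \<le> (5 * (84/83) ^ m) * 2"
      using flp_opt_bounds[of m] by (intro mult_mono) auto
    then show ?thesis
      using dst_opt_ge[of m] by simp
  qed
  \<comment> \<open>The witness for \<open>N\<close> is \<open>n = 5 * 3 ^ N\<close>, with the
    instance of word length \<open>N\<close>.\<close>
  have "N \<le> 5 * 3 ^ N" for N :: nat
    using less_exp[of N] power_mono[of "2::nat" 3 N] by linarith
  moreover have "flp_opt (edges m) (cost m) source (terminals m) > 0" for m
    using flp_opt_bounds(1)[of m] by linarith
  ultimately show ?thesis
    using \<delta> gap dst_instance_words card_verts dst_feasible_edges
    by (intro exI[of _ \<delta>] exI[of _ "1/10"] conjI allI) (simp, simp, simp, blast)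
qed

end
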